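(* In the variety of $2$-dimensional transposed Leibniz--Poisson algebras over $\mathbb C$, for the parametric families $T_5^{*}=\{T_5^{\alpha}\}_{\alpha\in\mathbb C}$ and $T_7^{*}=\{T_7^{\alpha}\}_{\alpha\in\mathbb C}$ one has: (i) $\overline{\bigcup_{\alpha}O(T_5^{\alpha})}$ contains $\overline{O(T_2)}$, $\overline{O(T_7^{0})}$, $\overline{O(T_8)}$ and $\overline{O(\mathbb C^8)}$; (ii) $\overline{\bigcup_{\alpha}O(T_7^{\alpha})}$ contains $\overline{O(T_1)}$ and $\overline{O(\mathbb C^8)}$.
   Context: A transposed Leibniz--Poisson algebra is a complex vector space with a commutative associative product $\cdot$ and a bilinear bracket $[-,-]$ satisfying $[[x,y],z]=[[x,z],y]+[x,[y,z]]$ and $[x,[y,z]]=[[x,y],z]+[y,[x,z]]$ (symmetric Leibniz), such that $2[x,y]\cdot z=[x\cdot z,y]+[x,y\cdot z]$. Fix a $2$-dimensional complex vector space $V$ with basis $e_1,e_2$. A $2$-dimensional such algebra is viewed as a pair $(\mu,\mu')\in \mathrm{Bil}(V\times V,V)^2\cong\mathbb C^{16}$ ($\mu$ is $\cdot$, $\mu'$ is the bracket). $\mathrm{GL}(V)$ acts by $(g*(\mu,\mu'))(x,y)=(g\mu(g^{-1}x,g^{-1}y),\,g\mu'(g^{-1}x,g^{-1}y))$; $O(T)$ is the orbit of a structure representing $T$; closures are Zariski closures. The algebras are (unlisted products are zero, $\cdot$ is commutative): $T_1: [e_1,e_1]=e_2$; $T_2: [e_1,e_2]=e_2,\ [e_2,e_1]=-e_2$;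 $T_5^{\alpha}: e_1\cdot e_1=e_1,\ e_1\cdot e_2=e_2,\ [e_1,e_2]=\alpha e_2,\ [e_2,e_1]=-\alpha e_2$; $T_7^{\alpha}: e_1\cdot e_1=e_2,\ [e_1,e_1]=\alpha e_2$; $T_8: e_1\cdot e_1=e_2,\ [e_1,e_2]=e_2,\ [e_2,e_1]=-e_2$; $\mathbb C^8$: the algebra with both products zero. *)

theory Defs
  imports "HOL-Analysis.Analysis"
begin

text \<open>The plane \<open>V\<close> is \<open>complex ^ 2\<close> with its standard basis; complex scalar multiplication on it
  is \<open>(*s)\<close> (the operation \<open>(*\<^sub>R)\<close> would only give real linearity).\<close>

type_synonym V = "complex ^ 2"
type_synonym structures = "(V \<Rightarrow> V \<Rightarrow> V) \<times> (V \<Rightarrow> V \<Rightarrow> V)"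

abbreviation e1 :: V where "e1 \<equiv> axis 1 1"
abbreviation e2 :: V where "e2 \<equiv> axis 2 1"

abbreviation clinear_map :: "(V \<Rightarrow> V) \<Rightarrow> bool" where
  "clinear_map \<equiv> Vector_Spaces.linear (*s) (*s)"

definition cbilinear :: "(V \<Rightarrow> V \<Rightarrow> V) \<Rightarrow> bool" where
  "cbilinear \<mu> \<longleftrightarrow> (\<forall>x. clinear_map (\<lambda>y. \<mu> x y)) \<and> (\<forall>y. clinear_map (\<lambda>x. \<mu> x y))"

definition Bil2 :: "structures set" where
  "Bil2 = {(\<mu>, \<nu>). cbilinear \<mu> \<and> cbilinear \<nu>}"

text \<open>In a pair \<open>(\<mu>, \<nu>)\<close>, \<open>\<mu> x y\<close> is the product of \<open>x\<close> and \<open>y\<close>, and \<open>\<nu> x y\<close> is their bracket.\<close>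

definition transposed_leibniz_poisson :: "structures set" where
  "transposed_leibniz_poisson = {(\<mu>, \<nu>). (\<mu>, \<nu>) \<in> Bil2
     \<and> (\<forall>x y. \<mu> x y = \<mu> y x)
     \<and> (\<forall>x y z. \<mu> (\<mu> x y) z = \<mu> x (\<mu> y z))
     \<and> (\<forall>x y z. \<nu> (\<nu> x y) z = \<nu> (\<nu> x z) y + \<nu> x (\<nu> y z))
     \<and> (\<forall>x y z. \<nu> x (\<nu> y z) = \<nu> (\<nu> x y) z + \<nu> y (\<nu> x z))
     \<and> (\<forall>x y z. 2 *s \<mu> (\<nu> x y) z = \<nu> (\<mu> x z) y + \<nu> x (\<mu> y z))}"

text \<open>The values \<open>\<mu> (axis i 1) (axis j 1) $ k\<close> and \<open>\<nu> (axis i 1) (axis j 1) $ k\<close> are the 16 structure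
  constants, i.e. the coordinates of \<open>Bil2\<close>.\<close>

inductive polynomial_on_bil :: "(structures \<Rightarrow> complex) \<Rightarrow> bool" where
  const: "polynomial_on_bil (\<lambda>_. c)"
| coord_prod: "polynomial_on_bil (\<lambda>(\<mu>, \<nu>). \<mu> (axis i 1) (axis j 1) $ k)"
| coord_bracket: "polynomial_on_bil (\<lambda>(\<mu>, \<nu>). \<nu> (axis i 1) (axis j 1) $ k)"
| add: "polynomial_on_bil f \<Longrightarrow> polynomial_on_bil g \<Longrightarrow> polynomial_on_bil (\<lambda>p. f p + g p)"
| mult: "polynomial_on_bil f \<Longrightarrow> polynomial_on_bil g \<Longrightarrow> polynomial_on_bil (\<lambda>p. f p * g p)"

definition zero_locus :: "(structures \<Rightarrow> complex) set \<Rightarrow> structures set" where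
  "zero_locus F = {p \<in> Bil2. \<forall>f\<in>F. f p = 0}"

definition zariski_topology :: "structures topology" where
  "zariski_topology =
     topology (\<lambda>U. \<exists>F. (\<forall>f\<in>F. polynomial_on_bil f) \<and> U = Bil2 - zero_locus F)"

definition variety_topology :: "structures topology" where
  "variety_topology = subtopology zariski_topology transposed_leibniz_poisson"

definition GL :: "(V \<Rightarrow> V) set" where
  "GL = {g. clinear_map g \<and> bij g}"

definition act :: "(V \<Rightarrow> V) \<Rightarrow> structures \<Rightarrow> structures" where
  "act g = (\<lambda>(\<mu>, \<nu>). (\<lambda>x y. g (\<mu> (inv g x) (inv g y)), \<lambda>x y. g (\<nu> (inv g x) (inv g y))))"

definition orbit :: "structures \<Rightarrow> structures set" where
  "orbit T = {act g T | g. g \<in> GL}"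

text \<open>\<open>bil_of_table a b c d\<close> is the bilinear map sending \<open>(e1, e1)\<close>, \<open>(e1, e2)\<close>, \<open>(e2, e1)\<close>, \<open>(e2, e2)\<close>
  to \<open>a\<close>, \<open>b\<close>, \<open>c\<close>, \<open>d\<close> respectively.\<close>

definition bil_of_table :: "V \<Rightarrow> V \<Rightarrow> V \<Rightarrow> V \<Rightarrow> V \<Rightarrow> V \<Rightarrow> V" where
  "bil_of_table a b c d x y =
     (x $ 1 * y $ 1) *s a + (x $ 1 * y $ 2) *s b + (x $ 2 * y $ 1) *s c + (x $ 2 * y $ 2) *s d"

definition T1 :: structures where
  "T1 = (bil_of_table 0 0 0 0, bil_of_table e2 0 0 0)"

definition T2 :: structures where
  "T2 = (bil_of_table 0 0 0 0, bil_of_table 0 e2 (- e2) 0)"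

definition T5 :: "complex \<Rightarrow> structures" where
  "T5 \<alpha> = (bil_of_table e1 e2 e2 0, bil_of_table 0 (\<alpha> *s e2) (- (\<alpha> *s e2)) 0)"

definition T7 :: "complex \<Rightarrow> structures" where
  "T7 \<alpha> = (bil_of_table e2 0 0 0, bil_of_table (\<alpha> *s e2) 0 0 0)"

definition T8 :: structures where
  "T8 = (bil_of_table e2 0 0 0, bil_of_table 0 e2 (- e2) 0)"

definition C8 :: structures where
  "C8 = (bil_of_table 0 0 0 0, bil_of_table 0 0 0 0)"

lemma clinear_mapI:
  assumes "\<And>x y. f (x + y) = f x + f y" "\<And>c x. f (c *s x) = c *s f x"
  shows "clinear_map f"
  using assms by (simp add: Vector_Spaces.linear_iff vec.vector_space_axioms)

lemma bil_of_table_nth: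
  "bil_of_table a b c d x y $ k =
     x $ 1 * y $ 1 * a $ k + x $ 1 * y $ 2 * b $ k + x $ 2 * y $ 1 * c $ k + x $ 2 * y $ 2 * d $ k"
  by (simp add: bil_of_table_def)

lemma e_nth: "e1 $ 1 = 1" "e1 $ 2 = 0" "e2 $ 1 = 0" "e2 $ 2 = 1"
  by (simp_all add: axis_def)

lemma cbilinear_bil_of_table: "cbilinear (bil_of_table a b c d)"
  unfolding cbilinear_def
  by (intro conjI allI clinear_mapI) (simp_all add: vec_eq_iff bil_of_table_nth algebra_simps)

lemma bil_of_table_basis:
  "bil_of_table a b c d e1 e1 = a" "bil_of_table a b c d e1 e2 = b"
  "bil_of_table a b c d e2 e1 = c" "bil_of_table a b c d e2 e2 = d"
  by (simp_all add: vec_eq_iff bil_of_table_nth e_nth)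

lemma algebras_in_variety:
  "T1 \<in> transposed_leibniz_poisson" "T2 \<in> transposed_leibniz_poisson"
  "T5 \<alpha> \<in> transposed_leibniz_poisson" "T7 \<alpha> \<in> transposed_leibniz_poisson"
  "T8 \<in> transposed_leibniz_poisson" "C8 \<in> transposed_leibniz_poisson"
  unfolding T1_def T2_def T5_def T7_def T8_def C8_def transposed_leibniz_poisson_def Bil2_def
    mem_Collect_eq prod.case
  by (intro conjI allI cbilinear_bil_of_table;
      simp only: vec_eq_iff forall_2 bil_of_table_nth e_nth vector_add_component
        vector_smult_component vector_uminus_component zero_index mult_zero_left mult_zero_right
        mult_1_right mult_1_left add_0_left add_0_right minus_zero;
      simp add: algebra_simps)+

lemma clinear_inv:
  assumes "g \<in> GL" shows "clinear_map (inv g)"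
proof -
  have g: "clinear_map g" "bij g" using assms by (auto simp: GL_def)
  have i: "g (inv g x) = x" for x using g(2) by (simp add: bij_is_surj surj_f_inv_f)
  have j: "inv g (g x) = x" for x using g(2) by (simp add: bij_is_inj)
  show ?thesis
  proof (rule clinear_mapI)
    fix x y show "inv g (x + y) = inv g x + inv g y"
      by (metis i j vec.linear_add[OF g(1)])
  next
    fix c x show "inv g (c *s x) = c *s inv g x"
      by (metis i j vec.linear_scale[OF g(1)])
  qed
qed

lemma cbilinear_act:
  assumes "g \<in> GL" "cbilinear \<mu>" shows "cbilinear (\<lambda>x y. g (\<mu> (inv g x) (inv g y)))"
proof -
  have g: "clinear_map g" using assms by (auto simp: GL_def)
  note c = Vector_Spaces.linear_compose[unfolded o_def]
  have m: "clinear_map (\<lambda>y. \<mu> x y)" "clinear_map (\<lambda>y. \<mu> y x)" for x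
    using assms(2) by (auto simp: cbilinear_def)
  show ?thesis unfolding cbilinear_def
    using c[OF c[OF clinear_inv[OF assms(1)] m(1)] g] c[OF c[OF clinear_inv[OF assms(1)] m(2)] g]
    by blast
qed

lemma orbit_subset_variety:
  assumes "T \<in> transposed_leibniz_poisson" shows "orbit T \<subseteq> transposed_leibniz_poisson"
proof
  fix S assume "S \<in> orbit T"
  then obtain g \<mu> \<nu> where g: "g \<in> GL" and T: "T = (\<mu>, \<nu>)" and S: "S = act g T"
    unfolding orbit_def by (cases T) auto
  have lin: "clinear_map g" "bij g" using g by (auto simp: GL_def)
  have j: "inv g (g x) = x" for x using lin(2) by (simp add: bij_is_inj)
  have a: "g (x + y) = g x + g y" "g (c *s x) = c *s g x" for x y c
    using vec.linear_add[OF lin(1)] vec.linear_scale[OF lin(1)] by auto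
  have P: "cbilinear \<mu>" "cbilinear \<nu>"
    "\<mu> x y = \<mu> y x"
    "\<mu> (\<mu> x y) z = \<mu> x (\<mu> y z)"
    "\<nu> (\<nu> x y) z = \<nu> (\<nu> x z) y + \<nu> x (\<nu> y z)"
    "\<nu> x (\<nu> y z) = \<nu> (\<nu> x y) z + \<nu> y (\<nu> x z)"
    "2 *s \<mu> (\<nu> x y) z = \<nu> (\<mu> x z) y + \<nu> x (\<mu> y z)" for x y z
    using assms unfolding T transposed_leibniz_poisson_def Bil2_def mem_Collect_eq prod.case
    by blast+
  show "S \<in> transposed_leibniz_poisson"
    unfolding S T act_def transposed_leibniz_poisson_def Bil2_def mem_Collect_eq prod.case j
      a[symmetric]
    by (intro conjI allI cbilinear_act g P(1,2) arg_cong[of _ _ g] P(3-7))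
qed

lemma istopology_zariski:
  "istopology (\<lambda>U. \<exists>F. (\<forall>f\<in>F. polynomial_on_bil f) \<and> U = Bil2 - zero_locus F)"
  (is "istopology ?P")
  unfolding istopology_def
proof (intro conjI allI impI)
  fix S T assume "?P S" "?P T"
  then obtain F G where F: "\<forall>f\<in>F. polynomial_on_bil f" "S = Bil2 - zero_locus F"
    and G: "\<forall>f\<in>G. polynomial_on_bil f" "T = Bil2 - zero_locus G" by blast
  let ?H = "{\<lambda>p. f p * g p | f g. f \<in> F \<and> g \<in> G}"
  have "\<forall>h\<in>?H. polynomial_on_bil h"
    using F(1) G(1) by (auto intro: polynomial_on_bil.mult)
  moreover have "S \<inter> T = Bil2 - zero_locus ?H"
    unfolding F(2) G(2) zero_locus_def by (auto; fastforce)
  ultimately show "?P (S \<inter> T)" by blast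
next
  fix K assume K: "\<forall>U\<in>K. ?P U"
  then obtain F where F: "\<And>U. U \<in> K \<Longrightarrow> (\<forall>f\<in>F U. polynomial_on_bil f)"
      "\<And>U. U \<in> K \<Longrightarrow> U = Bil2 - zero_locus (F U)" by metis
  have "\<Union>K = (\<Union>U\<in>K. Bil2 - zero_locus (F U))" using F(2) by auto
  also have "\<dots> = Bil2 - zero_locus (\<Union>U\<in>K. F U)"
    unfolding zero_locus_def by auto
  finally show "?P (\<Union>K)" using F(1) by (intro exI[of _ "\<Union>U\<in>K. F U"]) simp
qed

lemma openin_zariski:
  "openin zariski_topology U \<longleftrightarrow>
     (\<exists>F. (\<forall>f\<in>F. polynomial_on_bil f) \<and> U = Bil2 - zero_locus F)"
  unfolding zariski_topology_def by (simp add: istopology_zariski topology_inverse')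

lemma topspace_zariski [simp]: "topspace zariski_topology = Bil2"
proof
  show "topspace zariski_topology \<subseteq> Bil2"
    unfolding topspace_def openin_zariski by auto
  have "openin zariski_topology Bil2" unfolding openin_zariski
    by (rule exI[of _ "{\<lambda>_. 1}"]) (auto simp: zero_locus_def intro: polynomial_on_bil.const)
  then show "Bil2 \<subseteq> topspace zariski_topology" by (rule openin_subset)
qed

lemma closedin_zariski:
  "closedin zariski_topology Z \<longleftrightarrow> (\<exists>F. (\<forall>f\<in>F. polynomial_on_bil f) \<and> Z = zero_locus F)"
proof -
  have sub: "zero_locus F \<subseteq> Bil2" for F by (auto simp: zero_locus_def)
  have "Bil2 - Z = Bil2 - zero_locus F \<longleftrightarrow> Z = zero_locus F" if "Z \<subseteq> Bil2" for F
    using that sub[of F] by auto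
  then show ?thesis unfolding closedin_def openin_zariski topspace_zariski
    using sub by (metis (no_types, lifting))
qed

text \<open>The variety is Zariski closed, so closures in it are the closures in \<open>Bil2\<close>.\<close>

definition polynomial_vector :: "(structures \<Rightarrow> V) \<Rightarrow> bool" where
  "polynomial_vector h \<longleftrightarrow> (\<forall>k. \<exists>f. polynomial_on_bil f \<and> (\<forall>p\<in>Bil2. h p $ k = f p))"

lemma polynomial_vector_const: "polynomial_vector (\<lambda>_. c)"
  unfolding polynomial_vector_def
proof
  fix k show "\<exists>f. polynomial_on_bil f \<and> (\<forall>p\<in>Bil2. c $ k = f p)"
    by (intro exI[of _ "\<lambda>_. c $ k"]) (simp add: polynomial_on_bil.const)
qed

lemma polynomial_vector_add:
  assumes "polynomial_vector u" "polynomial_vector v"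
  shows "polynomial_vector (\<lambda>p. u p + v p)"
  unfolding polynomial_vector_def
proof
  fix k
  obtain f g where "polynomial_on_bil f" "polynomial_on_bil g"
    "\<forall>p\<in>Bil2. u p $ k = f p" "\<forall>p\<in>Bil2. v p $ k = g p"
    using assms unfolding polynomial_vector_def by meson
  then show "\<exists>f. polynomial_on_bil f \<and> (\<forall>p\<in>Bil2. (u p + v p) $ k = f p)"
    by (intro exI[of _ "\<lambda>p. f p + g p"]) (simp add: polynomial_on_bil.add)
qed

lemma cbilinear_expand:
  assumes "cbilinear \<mu>"
  shows "\<mu> x y = bil_of_table (\<mu> e1 e1) (\<mu> e1 e2) (\<mu> e2 e1) (\<mu> e2 e2) x y"
proof -
  have l: "clinear_map (\<lambda>y. \<mu> x y)" "clinear_map (\<lambda>x. \<mu> x y)" for x y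
    using assms by (auto simp: cbilinear_def)
  have basis: "z = z $ 1 *s e1 + z $ 2 *s e2" for z :: V
    by (simp add: vec_eq_iff forall_2 e_nth)
  have r: "\<mu> z y = z $ 1 *s \<mu> e1 y + z $ 2 *s \<mu> e2 y" for z y
    by (subst basis[of z]) (simp only: vec.linear_add[OF l(2)] vec.linear_scale[OF l(2)])
  have s: "\<mu> z y = y $ 1 *s \<mu> z e1 + y $ 2 *s \<mu> z e2" for z y
    by (subst basis[of y]) (simp only: vec.linear_add[OF l(1)] vec.linear_scale[OF l(1)])
  show ?thesis
    unfolding r[of x y] s[of e1 y] s[of e2 y] bil_of_table_def
    by (simp add: vec_eq_iff algebra_simps)
qed

lemma polynomial_vector_bil:
  assumes u: "polynomial_vector u" and v: "polynomial_vector v"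
    and m: "\<And>p. p \<in> Bil2 \<Longrightarrow> cbilinear (m p)"
    and c: "\<And>i j k. polynomial_on_bil (\<lambda>p. m p (axis i 1) (axis j 1) $ k)"
  shows "polynomial_vector (\<lambda>p. m p (u p) (v p))"
  unfolding polynomial_vector_def
proof
  fix k
  obtain f where f: "\<And>k. polynomial_on_bil (f k)" "\<And>k p. p \<in> Bil2 \<Longrightarrow> u p $ k = f k p"
    using u unfolding polynomial_vector_def by metis
  obtain g where g: "\<And>k. polynomial_on_bil (g k)" "\<And>k p. p \<in> Bil2 \<Longrightarrow> v p $ k = g k p"
    using v unfolding polynomial_vector_def by metis
  let ?h = "\<lambda>p. f 1 p * g 1 p * m p e1 e1 $ k + f 1 p * g 2 p * m p e1 e2 $ k
    + f 2 p * g 1 p * m p e2 e1 $ k + f 2 p * g 2 p * m p e2 e2 $ k"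
  have "polynomial_on_bil ?h"
    by (intro polynomial_on_bil.add polynomial_on_bil.mult f(1) g(1) c)
  moreover have "m p (u p) (v p) $ k = ?h p" if "p \<in> Bil2" for p
    by (subst cbilinear_expand[OF m[OF that]])
      (simp only: bil_of_table_nth f(2)[OF that] g(2)[OF that])
  ultimately show "\<exists>f. polynomial_on_bil f \<and> (\<forall>p\<in>Bil2. m p (u p) (v p) $ k = f p)"
    by blast
qed

lemma polynomial_vector_fst:
  assumes "polynomial_vector u" "polynomial_vector v"
  shows "polynomial_vector (\<lambda>p. fst p (u p) (v p))"
  using polynomial_on_bil.coord_prod
  by (intro polynomial_vector_bil[OF assms]) (auto simp: Bil2_def case_prod_unfold)

lemma polynomial_vector_snd:
  assumes "polynomial_vector u" "polynomial_vector v"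
  shows "polynomial_vector (\<lambda>p. snd p (u p) (v p))"
  using polynomial_on_bil.coord_bracket
  by (intro polynomial_vector_bil[OF assms]) (auto simp: Bil2_def case_prod_unfold)

lemma closedin_polynomial_equation:
  assumes u: "polynomial_vector u" and v: "polynomial_vector v"
  shows "closedin zariski_topology {p \<in> Bil2. u p = v p}"
proof -
  obtain f where f: "\<And>k. polynomial_on_bil (f k)" "\<And>k p. p \<in> Bil2 \<Longrightarrow> u p $ k = f k p"
    using u unfolding polynomial_vector_def by metis
  obtain g where g: "\<And>k. polynomial_on_bil (g k)" "\<And>k p. p \<in> Bil2 \<Longrightarrow> v p $ k = g k p"
    using v unfolding polynomial_vector_def by metis
  let ?F = "range (\<lambda>k p. f k p + (- 1) * g k p)"
  have eq: "u p = v p \<longleftrightarrow> (\<forall>h\<in>?F. h p = 0)" if "p \<in> Bil2" for p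
    using f(2)[OF that] g(2)[OF that] by (simp add: vec_eq_iff)
  have "\<forall>h\<in>?F. polynomial_on_bil h"
    using polynomial_on_bil.add[OF f(1) polynomial_on_bil.mult[OF polynomial_on_bil.const g(1)]]
    by blast
  moreover have "{p \<in> Bil2. u p = v p} = zero_locus ?F"
    unfolding zero_locus_def by (intro Collect_cong conj_cong refl eq)
  ultimately show ?thesis unfolding closedin_zariski by (intro exI[of _ ?F] conjI)
qed

lemma closedin_variety: "closedin zariski_topology transposed_leibniz_poisson"
proof -
  note pv = polynomial_vector_fst polynomial_vector_snd polynomial_vector_const
    polynomial_vector_add
  have two: "2 *s w = w + w" for w :: V by (simp add: vec_eq_iff)
  let ?E = "\<lambda>x y z. {p \<in> Bil2. fst p x y = fst p y x}
      \<inter> {p \<in> Bil2. fst p (fst p x y) z = fst p x (fst p y z)}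
      \<inter> {p \<in> Bil2. snd p (snd p x y) z = snd p (snd p x z) y + snd p x (snd p y z)}
      \<inter> {p \<in> Bil2. snd p x (snd p y z) = snd p (snd p x y) z + snd p y (snd p x z)}
      \<inter> {p \<in> Bil2. fst p (snd p x y) z + fst p (snd p x y) z
            = snd p (fst p x z) y + snd p x (fst p y z)}"
  have "closedin zariski_topology (?E x y z)" for x y z
    by (intro closedin_Int closedin_polynomial_equation pv)
  then have "closedin zariski_topology (\<Inter>(range (\<lambda>(x, y, z). ?E x y z)))"
    by (intro closedin_Inter) auto
  also have "\<Inter>(range (\<lambda>(x, y, z). ?E x y z)) = transposed_leibniz_poisson"
    proof (intro set_eqI iffI)
    fix p assume "p \<in> \<Inter>(range (\<lambda>(x, y, z). ?E x y z))"
    then have "p \<in> ?E x y z" for x y z by (metis (no_types, lifting) INT_E UNIV_I case_prod_conv)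
    then have H: "p \<in> Bil2" "fst p x y = fst p y x" "fst p (fst p x y) z = fst p x (fst p y z)"
      "snd p (snd p x y) z = snd p (snd p x z) y + snd p x (snd p y z)"
      "snd p x (snd p y z) = snd p (snd p x y) z + snd p y (snd p x z)"
      "fst p (snd p x y) z + fst p (snd p x y) z = snd p (fst p x z) y + snd p x (fst p y z)"
      for x y z
      unfolding Int_iff mem_Collect_eq by blast+
    show "p \<in> transposed_leibniz_poisson"
      unfolding transposed_leibniz_poisson_def two mem_Collect_eq case_prod_unfold prod.collapse
      by (intro conjI allI H)
  next
    fix p assume "p \<in> transposed_leibniz_poisson"
    then have H: "p \<in> Bil2" "fst p x y = fst p y x" "fst p (fst p x y) z = fst p x (fst p y z)"
      "snd p (snd p x y) z = snd p (snd p x z) y + snd p x (snd p y z)"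
      "snd p x (snd p y z) = snd p (snd p x y) z + snd p y (snd p x z)"
      "fst p (snd p x y) z + fst p (snd p x y) z = snd p (fst p x z) y + snd p x (fst p y z)"
      for x y z
      unfolding transposed_leibniz_poisson_def two mem_Collect_eq case_prod_unfold prod.collapse
      by blast+
    show "p \<in> \<Inter>(range (\<lambda>(x, y, z). ?E x y z))"
      unfolding INT_iff case_prod_unfold
      by (intro ballI IntI CollectI conjI H)
  qed
  finally show ?thesis .
qed

lemma closure_of_variety_topology:
  assumes "S \<subseteq> transposed_leibniz_poisson"
  shows "variety_topology closure_of S = zariski_topology closure_of S"
proof -
  have "zariski_topology closure_of S \<subseteq> transposed_leibniz_poisson"
    using closure_of_minimal[OF assms closedin_variety] .
  then show ?thesis
    unfolding variety_topology_def closure_of_subtopology using assms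
    by (simp add: Int_absorb1)
qed

end

theory Submission
  imports Defs
begin

text \<open>Polynomials are continuous, so Zariski closures contain limits of the structure constants.
  In the basis \<open>t e\<^sub>1 + (c/t) e\<^sub>2, e\<^sub>2\<close> the algebra \<open>T\<^sub>5\<close> with parameter \<open>\<beta>/t\<close> has the products
  \<open>e\<^sub>1e\<^sub>1 = t e\<^sub>1 + c e\<^sub>2\<close>, \<open>e\<^sub>1e\<^sub>2 = t e\<^sub>2\<close>, \<open>[e\<^sub>1, e\<^sub>2] = \<beta> e\<^sub>2\<close>, and \<open>t \<rightarrow> 0\<close> with
  \<open>c, \<beta> \<in> {0, 1}\<close> yields the four algebras of the first part. In the basis \<open>e\<^sub>1, e\<^sub>2/s\<close> the
  algebra \<open>T\<^sub>7\<close> with parameter \<open>\<beta>/s\<close> has \<open>e\<^sub>1e\<^sub>1 = s e\<^sub>2\<close> and \<open>[e\<^sub>1, e\<^sub>1] = \<beta> e\<^sub>2\<close>; let \<open>s \<rightarrow> 0\<close>.\<close>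

text \<open>Evaluation at basis vectors and taking a component preserve limits, and so do sums and
  products. Convergence at all vectors, not only at the basis, is a form that survives
  \<open>act g\<close>.\<close>

lemma tendsto_polynomial_on_bil:
  assumes "polynomial_on_bil f"
    and "\<And>x y. ((\<lambda>t. fst (S t) x y) \<longlongrightarrow> fst p x y) F"
    and "\<And>x y. ((\<lambda>t. snd (S t) x y) \<longlongrightarrow> snd p x y) F"
  shows "((\<lambda>t. f (S t)) \<longlongrightarrow> f p) F"
  using assms(1)
  by induction (auto simp: case_prod_unfold intro!: tendsto_intros assms(2,3))

text \<open>The closure is the zero locus of some polynomials. Each of them vanishes eventually
  along \<open>S\<close>, hence at the limit by continuity and uniqueness of limits.\<close>

lemma limit_in_zariski_closure:
  assumes "F \<noteq> bot" "A \<subseteq> Bil2" "p \<in> Bil2"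
    and ev: "\<forall>\<^sub>F t in F. S t \<in> A"
    and lim: "\<And>x y. ((\<lambda>t. fst (S t) x y) \<longlongrightarrow> fst p x y) F"
      "\<And>x y. ((\<lambda>t. snd (S t) x y) \<longlongrightarrow> snd p x y) F"
  shows "p \<in> zariski_topology closure_of A"
proof -
  obtain E where E: "\<forall>f\<in>E. polynomial_on_bil f"
    "zariski_topology closure_of A = zero_locus E"
    using closedin_closure_of closedin_zariski by metis
  have sub: "A \<subseteq> zero_locus E"
    using closure_of_subset[of A zariski_topology] assms(2) E(2) by simp
  have "f p = 0" if "f \<in> E" for f
  proof -
    have "\<forall>\<^sub>F t in F. f (S t) = 0"
      using ev by eventually_elim (use sub that in \<open>auto simp: zero_locus_def\<close>)
    then have "((\<lambda>t. f (S t)) \<longlongrightarrow> 0) F" by (rule tendsto_eventually)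
    moreover have "((\<lambda>t. f (S t)) \<longlongrightarrow> f p) F"
      using tendsto_polynomial_on_bil[OF _ lim] E(1) that by blast
    ultimately show ?thesis using assms(1) tendsto_unique by blast
  qed
  then show ?thesis using assms(3) E(2) by (simp add: zero_locus_def)
qed

text \<open>A complex linear map is real linear, hence bounded because the space has finite
  dimension.\<close>

lemma clinear_map_tendsto:
  assumes "clinear_map g" "(u \<longlongrightarrow> l) F"
  shows "((\<lambda>t. g (u t)) \<longlongrightarrow> g l) F"
proof -
  have "linear g"
  proof (rule linearI)
    fix x y show "g (x + y) = g x + g y" by (rule vec.linear_add[OF assms(1)])
  next
    fix r x
    have "r *\<^sub>R z = complex_of_real r *s z" for z :: V
      by (simp only: vec_eq_iff vector_scaleR_component vector_smult_component)
        (simp add: scaleR_conv_of_real)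
    then show "g (r *\<^sub>R x) = r *\<^sub>R g x" by (simp add: vec.linear_scale[OF assms(1)])
  qed
  then show ?thesis using assms(2)
    by (simp add: bounded_linear.tendsto linear_conv_bounded_linear)
qed

lemma act_orbit:
  assumes "h \<in> GL" "S \<in> orbit T"
  shows "act h S \<in> orbit T"
proof -
  obtain g where g: "g \<in> GL" "S = act g T" using assms(2) by (auto simp: orbit_def)
  have b: "bij h" "bij g" "clinear_map h" "clinear_map g" using assms(1) g(1) by (auto simp: GL_def)
  have "h \<circ> g \<in> GL"
    using b Vector_Spaces.linear_compose bij_comp by (auto simp: GL_def)
  moreover have "act h S = act (h \<circ> g) T"
    unfolding g(2) act_def o_inv_distrib[OF b(1,2)] by (simp add: case_prod_unfold)
  ultimately show ?thesis by (auto simp: orbit_def)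
qed

text \<open>One limit settles the whole orbit of \<open>p\<close>: applying \<open>act g\<close> to
  the family \<open>S\<close> keeps it in the union of orbits and moves its limit to
  \<open>act g p\<close>.\<close>

lemma degeneration:
  assumes "F \<noteq> bot" "\<And>\<alpha>. T \<alpha> \<in> transposed_leibniz_poisson" "p \<in> transposed_leibniz_poisson"
    and ev: "\<forall>\<^sub>F t in F. S t \<in> (\<Union>\<alpha>. orbit (T \<alpha>))"
    and lim: "\<And>x y. ((\<lambda>t. fst (S t) x y) \<longlongrightarrow> fst p x y) F"
      "\<And>x y. ((\<lambda>t. snd (S t) x y) \<longlongrightarrow> snd p x y) F"
  shows "variety_topology closure_of orbit p \<subseteq> variety_topology closure_of (\<Union>\<alpha>. orbit (T \<alpha>))"
proof -
  let ?A = "\<Union>\<alpha>. orbit (T \<alpha>)"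
  have A: "?A \<subseteq> transposed_leibniz_poisson" using orbit_subset_variety assms(2) by blast
  have V: "transposed_leibniz_poisson \<subseteq> Bil2" by (auto simp: transposed_leibniz_poisson_def)
  have "act g p \<in> zariski_topology closure_of ?A" if g: "g \<in> GL" for g
  proof (rule limit_in_zariski_closure[OF assms(1), where S = "\<lambda>t. act g (S t)"])
    show "?A \<subseteq> Bil2" using A V by blast
    show "act g p \<in> Bil2"
      using g orbit_subset_variety[OF assms(3)] V by (auto simp: orbit_def)
    show "\<forall>\<^sub>F t in F. act g (S t) \<in> ?A"
      using ev by eventually_elim (use act_orbit[OF g] in blast)
    have "clinear_map g" using g by (simp add: GL_def)
    from clinear_map_tendsto[OF this lim(1)] clinear_map_tendsto[OF this lim(2)]
    show "((\<lambda>t. fst (act g (S t)) x y) \<longlongrightarrow> fst (act g p) x y) F"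
      "((\<lambda>t. snd (act g (S t)) x y) \<longlongrightarrow> snd (act g p) x y) F" for x y
      by (simp_all add: act_def case_prod_unfold)
  qed
  then have "orbit p \<subseteq> variety_topology closure_of ?A"
    \<comment> \<open>The variety is closed, so both topologies give the same closure.\<close>
    unfolding closure_of_variety_topology[OF A] by (auto simp: orbit_def)
  then show ?thesis by (simp add: closure_of_minimal)
qed

text \<open>\<open>P\<close> is an isomorphism from the new structure to the old one, so
  \<open>inv P\<close> is the acting group element; the hypotheses avoid inverses.\<close>

lemma orbitI:
  assumes P: "P \<in> GL"
    and "\<And>x y. \<mu> (P x) (P y) = P (\<mu>' x y)" "\<And>x y. \<nu> (P x) (P y) = P (\<nu>' x y)"
  shows "(\<mu>', \<nu>') \<in> orbit (\<mu>, \<nu>)"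
proof -
  have b: "bij P" using P by (simp add: GL_def)
  have "inv P \<in> GL" using clinear_inv[OF P] bij_imp_bij_inv[OF b] by (simp add: GL_def)
  moreover have "(\<mu>', \<nu>') = act (inv P) (\<mu>, \<nu>)"
    using b by (simp add: act_def inv_inv_eq assms(2,3) bij_is_inj)
  ultimately show ?thesis by (auto simp: orbit_def)
qed

text \<open>The images of \<open>e1\<close> and \<open>e2\<close> are the new basis vectors in which
  a multiplication table is rewritten.\<close>

definition lower_triangular :: "complex \<Rightarrow> complex \<Rightarrow> complex \<Rightarrow> V \<Rightarrow> V" where
  "lower_triangular s a b x = (s * x $ 1) *s e1 + (a * x $ 1 + b * x $ 2) *s e2"

lemma lower_triangular_nth:
  "lower_triangular s a b x $ 1 = s * x $ 1"
  "lower_triangular s a b x $ 2 = a * x $ 1 + b * x $ 2"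
  by (simp_all add: lower_triangular_def e_nth)

lemma lower_triangular_GL:
  assumes "s \<noteq> 0" "b \<noteq> 0"
  shows "lower_triangular s a b \<in> GL"
proof -
  have "clinear_map (lower_triangular s a b)"
    by (rule clinear_mapI)
      (simp_all add: vec_eq_iff forall_2 lower_triangular_nth algebra_simps)
  moreover have "bij (lower_triangular s a b)"
    \<comment> \<open>The inverse matrix is again lower triangular.\<close>
    by (rule o_bij[where g = "lower_triangular (1 / s) (- a / (s * b)) (1 / b)"])
      (use assms in \<open>auto simp: fun_eq_iff vec_eq_iff forall_2 lower_triangular_nth field_simps\<close>)
  ultimately show ?thesis by (simp add: GL_def)
qed

lemma T5_orbit:
  assumes "t \<noteq> 0"
  shows "(bil_of_table (t *s e1 + c *s e2) (t *s e2) (t *s e2) 0,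
      bil_of_table 0 (\<beta> *s e2) (- (\<beta> *s e2)) 0) \<in> orbit (T5 (\<beta> / t))"
  unfolding T5_def
  \<comment> \<open>Here \<open>b = 1\<close> and \<open>a = c / t\<close>. The square of
    \<open>t e1 + (c/t) e2\<close> is \<open>t^2 e1 + 2c e2\<close>, that is, \<open>t\<close> times
    this vector plus \<open>c e2\<close>.\<close>
  by (rule orbitI[OF lower_triangular_GL[OF assms, of 1 "c / t"]])
    (use assms in \<open>simp_all add: vec_eq_iff forall_2 lower_triangular_nth bil_of_table_nth
      e_nth field_simps\<close>)

lemma T7_orbit:
  assumes "s \<noteq> 0"
  shows "(bil_of_table (s *s e2) 0 0 0, bil_of_table (\<beta> *s e2) 0 0 0) \<in> orbit (T7 (\<beta> / s))"
  unfolding T7_def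
  by (rule orbitI[OF lower_triangular_GL[of 1 "1 / s" 0]])
    (use assms in \<open>simp_all add: vec_eq_iff forall_2 lower_triangular_nth bil_of_table_nth
      e_nth field_simps\<close>)

lemma tendsto_bil_of_table:
  assumes "(a \<longlongrightarrow> a') F" "(b \<longlongrightarrow> b') F" "(c \<longlongrightarrow> c') F" "(d \<longlongrightarrow> d') F"
  shows "((\<lambda>t. bil_of_table (a t) (b t) (c t) (d t) x y) \<longlongrightarrow> bil_of_table a' b' c' d' x y) F"
  by (rule vec_tendstoI) (auto simp: bil_of_table_nth intro!: tendsto_intros assms)

lemma tendsto_id_smult: "((\<lambda>t. t *s v) \<longlongrightarrow> 0) (at (0 :: complex))" for v :: V
  by (rule vec_tendstoI) (auto intro!: tendsto_eq_intros)

text \<open>The parameter \<open>\<beta> / t\<close> of \<open>T5_orbit\<close> varies with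
  \<open>t\<close> when \<open>\<beta>\<close> is nonzero, hence the union over the family.\<close>

lemma T5_degeneration:
  assumes "(bil_of_table (c *s e2) 0 0 0, bil_of_table 0 (\<beta> *s e2) (- (\<beta> *s e2)) 0)
      \<in> transposed_leibniz_poisson" (is "?p \<in> _")
  shows "variety_topology closure_of orbit ?p
    \<subseteq> variety_topology closure_of (\<Union>\<alpha>. orbit (T5 \<alpha>))"
proof (rule degeneration[OF at_neq_bot algebras_in_variety(3) assms])
  let ?S = "\<lambda>t. (bil_of_table (t *s e1 + c *s e2) (t *s e2) (t *s e2) 0,
      bil_of_table 0 (\<beta> *s e2) (- (\<beta> *s e2)) 0)"
  show "\<forall>\<^sub>F t in at 0. ?S t \<in> (\<Union>\<alpha>. orbit (T5 \<alpha>))"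
    \<comment> \<open>The base change exists only for nonzero \<open>t\<close>, which
      \<open>at 0\<close> guarantees.\<close>
    using eventually_neq_at_within[of 0] by eventually_elim (use T5_orbit in blast)
  show "((\<lambda>t. fst (?S t) x y) \<longlongrightarrow> fst ?p x y) (at 0)" for x y
    unfolding fst_conv
    by (intro tendsto_bil_of_table tendsto_id_smult tendsto_const
        tendsto_add[OF tendsto_id_smult tendsto_const, simplified])
  show "((\<lambda>t. snd (?S t) x y) \<longlongrightarrow> snd ?p x y) (at 0)" for x y
    by simp
qed

text \<open>Along the base change of \<open>T7_orbit\<close> the bracket stays fixed while the
  product \<open>s e2\<close> tends to zero.\<close>

lemma T7_degeneration:
  assumes "(bil_of_table 0 0 0 0, bil_of_table (\<beta> *s e2) 0 0 0) \<in> transposed_leibniz_poisson"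
    (is "?p \<in> _")
  shows "variety_topology closure_of orbit ?p
    \<subseteq> variety_topology closure_of (\<Union>\<alpha>. orbit (T7 \<alpha>))"
proof (rule degeneration[OF at_neq_bot algebras_in_variety(4) assms])
  let ?S = "\<lambda>s. (bil_of_table (s *s e2) 0 0 0, bil_of_table (\<beta> *s e2) 0 0 0)"
  show "\<forall>\<^sub>F s in at 0. ?S s \<in> (\<Union>\<alpha>. orbit (T7 \<alpha>))"
    using eventually_neq_at_within[of 0] by eventually_elim (use T7_orbit in blast)
  show "((\<lambda>t. fst (?S t) x y) \<longlongrightarrow> fst ?p x y) (at 0)" for x y
    unfolding fst_conv by (intro tendsto_bil_of_table tendsto_id_smult tendsto_const)
  show "((\<lambda>t. snd (?S t) x y) \<longlongrightarrow> snd ?p x y) (at 0)" for x y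
    by simp
qed

theorem lemma28:
  shows
    "(variety_topology closure_of orbit T2 \<subseteq> variety_topology closure_of (\<Union>\<alpha>. orbit (T5 \<alpha>)) \<and>
      variety_topology closure_of orbit (T7 0) \<subseteq> variety_topology closure_of (\<Union>\<alpha>. orbit (T5 \<alpha>)) \<and>
      variety_topology closure_of orbit T8 \<subseteq> variety_topology closure_of (\<Union>\<alpha>. orbit (T5 \<alpha>)) \<and>
      variety_topology closure_of orbit C8 \<subseteq> variety_topology closure_of (\<Union>\<alpha>. orbit (T5 \<alpha>))) \<and>
     (variety_topology closure_of orbit T1 \<subseteq> variety_topology closure_of (\<Union>\<alpha>. orbit (T7 \<alpha>)) \<and>
      variety_topology closure_of orbit C8 \<subseteq> variety_topology closure_of (\<Union>\<alpha>. orbit (T7 \<alpha>)))"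
proof -
  \<comment> \<open>The pairs \<open>(c, \<beta>)\<close> are (0,1), (1,0), (1,1), (0,0) for the
    limits of \<open>T5\<close>; \<open>\<beta>\<close> is 1, 0 for those of \<open>T7\<close>. The
    scalars stay explicit so that \<open>folded\<close> matches.\<close>
  have T: "T2 = (bil_of_table (0 *s e2) 0 0 0, bil_of_table 0 (1 *s e2) (- (1 *s e2)) 0)"
    "T7 0 = (bil_of_table (1 *s e2) 0 0 0, bil_of_table 0 (0 *s e2) (- (0 *s e2)) 0)"
    "T8 = (bil_of_table (1 *s e2) 0 0 0, bil_of_table 0 (1 *s e2) (- (1 *s e2)) 0)"
    "C8 = (bil_of_table (0 *s e2) 0 0 0, bil_of_table 0 (0 *s e2) (- (0 *s e2)) 0)"
    "T1 = (bil_of_table 0 0 0 0, bil_of_table (1 *s e2) 0 0 0)"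
    "C8 = (bil_of_table 0 0 0 0, bil_of_table (0 *s e2) 0 0 0)"
    by (simp_all add: T1_def T2_def T7_def T8_def C8_def)
  show ?thesis
    by (intro conjI
        T5_degeneration[of 0 1, folded T(1), OF algebras_in_variety(2)]
        T5_degeneration[of 1 0, folded T(2), OF algebras_in_variety(4)]
        T5_degeneration[of 1 1, folded T(3), OF algebras_in_variety(5)]
        T5_degeneration[of 0 0, folded T(4), OF algebras_in_variety(6)]
        T7_degeneration[of 1, folded T(5), OF algebras_in_variety(1)]
        T7_degeneration[of 0, folded T(6), OF algebras_in_variety(6)])
qed

end
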